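(* Let $S$ be a finitely generated, commutative, reduced and cancellative semigroup with zero element (not necessarily torsion-free), minimally generated by a disjoint union $A_1\sqcup A_2$ of nonempty finite sets $A_1=\{a_1,\dots,a_r\}$ and $A_2=\{b_1,\dots,b_t\}$, and put $S_1=\langle A_1\rangle$ and $S_2=\langle A_2\rangle$. Then $S$ is the gluing of $S_1$ and $S_2$ if and only if there exists $d\in (S_1\cap S_2)\setminus\{0\}$ such that $G(S_1)\cap G(S_2)=d\mathbb{Z}$.
   Context: Semigroups are commutative with zero element $0$, and $\langle A\rangle$ is the subsemigroup (containing $0$) generated by $A$. $S$ is cancellative if $m+n=m+n'$ implies $n=n'$, so $S$ embeds in its associated commutative group $G(S)$. $S$ is reduced if $S\cap(-S)=\{0\}$. For a subsemigroup $S_i\subseteq S$, $G(S_i)$ is the subgroup of $G(S)$ generated by $S_i$, and $d\mathbb{Z}$ is the subgroup generated by $d$. "Minimally generated" means no proper subset of the generating set generates $S$. Let $\Bbbk$ be a field. The semigroup ideal $I_S\subset \Bbbk[X_1,\dots,X_r,Y_1,\dots,Y_t]$ is the ideal generated by all $X^\alpha Y^\beta-X^\gamma Y^\delta$ with $\sum\alpha_i a_i+\sum\beta_i b_i=\sum\gamma_i a_i+\sum\delta_i b_i$. Similarly $I_{S_1}\subset\Bbbk[X_1,\dots,X_r]$ and $I_{S_2}\subset \Bbbk[Y_1,\dots,Y_t]$ are defined from $A_1$ and $A_2$, and are regarded as generating ideals in the big ring. Definition (gluing). $S$ is the gluing of $S_1$ and $S_2$ if there is a nonzero binomial $X^{\gamma_X}-Y^{\gamma_Y}\in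 I_S$ with $\gamma_X\in\mathbb{N}^r$, $\gamma_Y\in\mathbb{N}^t$ such that $I_S=I_{S_1}+I_{S_2}+\langle X^{\gamma_X}-Y^{\gamma_Y}\rangle$. *)

theory Defs
  imports
    Complex_Main
    "HOL-Library.Poly_Mapping"
    "HOL-Library.Set_Algebras"
    "HOL-Computational_Algebra.Group_Closure"
begin

section \<open>Commutative semigroups with zero\<close>

text \<open>
  The semigroup \<open>S\<close> is the whole of a type of class \<^class>\<open>comm_monoid_add\<close>. The class
  \<^class>\<open>cancel_comm_monoid_add\<close> is avoided on purpose: it also contains a subtraction
  operation with axioms of its own, so cancellativity is a separate predicate.
\<close>

definition cancellative :: "'s::comm_monoid_add itself \<Rightarrow> bool" where
  "cancellative _ \<longleftrightarrow> (\<forall>m n n' :: 's. m + n = m + n' \<longrightarrow> n = n')"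

inductive_set monoid_closure :: "'s::comm_monoid_add set \<Rightarrow> 's set" for A where
  zero: "0 \<in> monoid_closure A"
| base: "x \<in> A \<Longrightarrow> x \<in> monoid_closure A"
| add: "x \<in> monoid_closure A \<Longrightarrow> y \<in> monoid_closure A \<Longrightarrow> x + y \<in> monoid_closure A"

definition minimally_generates :: "'s::comm_monoid_add set \<Rightarrow> bool" where
  "minimally_generates A \<longleftrightarrow>
     monoid_closure A = UNIV \<and> (\<forall>B. B \<subset> A \<longrightarrow> monoid_closure B \<noteq> UNIV)"


section \<open>The associated commutative group\<close>

text \<open>
  The pair \<open>(m, n)\<close> represents the formal difference \<open>m - n\<close>. The summand \<open>k\<close> makes the
  relation transitive without cancellativity.
\<close>

definition diff_rel :: "'s::comm_monoid_add \<times> 's \<Rightarrow> 's \<times> 's \<Rightarrow> bool" where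
  "diff_rel p q \<longleftrightarrow> (\<exists>k. fst p + snd q + k = fst q + snd p + k)"

lemma equivp_diff_rel: "equivp (diff_rel :: 's::comm_monoid_add \<times> 's \<Rightarrow> _)"
proof (rule equivpI)
  show "reflp (diff_rel :: 's \<times> 's \<Rightarrow> _)"
    by (auto simp: reflp_def diff_rel_def)
  show "symp (diff_rel :: 's \<times> 's \<Rightarrow> _)"
    unfolding symp_def diff_rel_def by metis
  show "transp (diff_rel :: 's \<times> 's \<Rightarrow> _)"
  proof (rule transpI)
    fix p q r :: "'s \<times> 's"
    assume "diff_rel p q" "diff_rel q r"
    then obtain k l where
      k: "fst p + snd q + k = fst q + snd p + k" and
      l: "fst q + snd r + l = fst r + snd q + l"
      unfolding diff_rel_def by blast
    have "fst p + snd r + (snd q + k + l) = (fst p + snd q + k) + (snd r + l)"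
      by (simp add: ac_simps)
    also have "\<dots> = (fst q + snd r + l) + (snd p + k)"
      unfolding k by (simp add: ac_simps)
    also have "\<dots> = fst r + snd p + (snd q + k + l)"
      unfolding l by (simp add: ac_simps)
    finally show "diff_rel p r"
      unfolding diff_rel_def by blast
  qed
qed

quotient_type (overloaded) 's diff_group = "'s::comm_monoid_add \<times> 's" / diff_rel
  by (rule equivp_diff_rel)

instantiation diff_group :: (comm_monoid_add) ab_group_add
begin

lift_definition zero_diff_group :: "'a diff_group" is "(0, 0)" .

lift_definition plus_diff_group :: "'a diff_group \<Rightarrow> 'a diff_group \<Rightarrow> 'a diff_group"
  is "\<lambda>p q. (fst p + fst q, snd p + snd q)"
proof -
  fix p p' q q' :: "'a \<times> 'a"
  assume "diff_rel p p'" "diff_rel q q'"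
  then obtain k l where
    k: "fst p + snd p' + k = fst p' + snd p + k" and
    l: "fst q + snd q' + l = fst q' + snd q + l"
    unfolding diff_rel_def by blast
  have "(fst p + fst q) + (snd p' + snd q') + (k + l)
      = (fst p + snd p' + k) + (fst q + snd q' + l)"
    by (simp add: ac_simps)
  also have "\<dots> = (fst p' + fst q') + (snd p + snd q) + (k + l)"
    unfolding k l by (simp add: ac_simps)
  finally show "diff_rel (fst p + fst q, snd p + snd q) (fst p' + fst q', snd p' + snd q')"
    unfolding diff_rel_def by auto
qed

lift_definition uminus_diff_group :: "'a diff_group \<Rightarrow> 'a diff_group"
  is "\<lambda>p. (snd p, fst p)"
  unfolding diff_rel_def by (metis add.commute fst_conv snd_conv)

definition minus_diff_group :: "'a diff_group \<Rightarrow> 'a diff_group \<Rightarrow> 'a diff_group" where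
  "minus_diff_group x y = x + - y"

instance
proof
  fix x y z :: "'a diff_group"
  show "x + y + z = x + (y + z)"
    by transfer (auto simp: diff_rel_def ac_simps)
  show "x + y = y + x"
    by transfer (auto simp: diff_rel_def ac_simps)
  show "0 + x = x"
    by transfer (auto simp: diff_rel_def)
  show "- x + x = 0"
    by transfer (auto simp: diff_rel_def ac_simps)
  show "x - y = x + - y"
    by (simp add: minus_diff_group_def)
qed

end

lift_definition incl :: "'s::comm_monoid_add \<Rightarrow> 's diff_group" is "\<lambda>m. (m, 0)" .

lemma incl_zero: "incl 0 = 0"
  by transfer (simp add: diff_rel_def)

lemma incl_add: "incl (m + n) = incl m + incl n"
  by transfer (simp add: diff_rel_def)

lemma inj_incl:
  assumes "cancellative TYPE('s::comm_monoid_add)"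
  shows "inj (incl :: 's \<Rightarrow> _)"
proof (rule injI)
  fix m n :: 's
  assume "incl m = incl n"
  then have "\<exists>k. m + k = n + k"
    by transfer (simp add: diff_rel_def)
  then show "m = n"
    using assms unfolding cancellative_def by (metis add.commute)
qed

definition reduced :: "'s::comm_monoid_add itself \<Rightarrow> bool" where
  "reduced _ \<longleftrightarrow> range (incl :: 's \<Rightarrow> _) \<inter> uminus ` range (incl :: 's \<Rightarrow> _) = {0}"

text \<open>\<open>G(T)\<close> for a subsemigroup \<open>T\<close>, as a subgroup of \<open>G(S)\<close>.\<close>

definition group_of :: "'s::comm_monoid_add set \<Rightarrow> 's diff_group set" where
  "group_of T = group_closure (incl ` T)"


section \<open>Polynomials and semigroup ideals\<close>

text \<open>Polynomials over \<open>'k\<close> in variables indexed by \<open>'v\<close>; \<open>'v \<Rightarrow>\<^sub>0 nat\<close> are the exponents.\<close>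

type_synonym ('v, 'k) mpoly = "('v \<Rightarrow>\<^sub>0 nat) \<Rightarrow>\<^sub>0 'k"

definition monomial :: "('v \<Rightarrow>\<^sub>0 nat) \<Rightarrow> ('v, 'k::comm_ring_1) mpoly" where
  "monomial \<alpha> = Poly_Mapping.single \<alpha> 1"

definition ideal_gen :: "'a::comm_ring_1 set \<Rightarrow> 'a set" where
  "ideal_gen B = module.span (*) B"

text \<open>\<open>weight c \<alpha>\<close> is \<open>\<Sum>\<^sub>v \<alpha>\<^sub>v c\<^sub>v\<close>; the inner sum is the multiple \<open>\<alpha>\<^sub>v c\<^sub>v\<close>.\<close>

definition weight :: "('v::finite \<Rightarrow> 's::comm_monoid_add) \<Rightarrow> ('v \<Rightarrow>\<^sub>0 nat) \<Rightarrow> 's" where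
  "weight c \<alpha> = (\<Sum>v\<in>UNIV. \<Sum>i<Poly_Mapping.lookup \<alpha> v. c v)"

definition semigroup_ideal ::
    "('v::finite \<Rightarrow> 's::comm_monoid_add) \<Rightarrow> ('v, 'k::comm_ring_1) mpoly set" where
  "semigroup_ideal c =
     ideal_gen {monomial \<alpha> - monomial \<beta> | \<alpha> \<beta>. weight c \<alpha> = weight c \<beta>}"

text \<open>
  Pushing forward along an injection of index sets extends by zero. Applied to exponents it
  renames variables; applied twice it embeds one polynomial ring into another.
\<close>

definition push :: "('a \<Rightarrow> 'b) \<Rightarrow> ('a \<Rightarrow>\<^sub>0 'c::comm_monoid_add) \<Rightarrow> ('b \<Rightarrow>\<^sub>0 'c)" where
  "push f p = (\<Sum>k\<in>Poly_Mapping.keys p. Poly_Mapping.single (f k) (Poly_Mapping.lookup p k))"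

lemma lookup_push:
  assumes "inj f"
  shows "Poly_Mapping.lookup (push f p) (f k) = Poly_Mapping.lookup p k"
proof -
  have "Poly_Mapping.lookup (push f p) (f k)
      = (\<Sum>l\<in>Poly_Mapping.keys p. if l = k then Poly_Mapping.lookup p k else 0)"
    using assms
    by (auto simp: push_def lookup_sum lookup_single when_def inj_eq intro!: sum.cong)
  then show ?thesis
    by (simp add: in_keys_iff)
qed

lemma lookup_push_outside:
  assumes "l \<notin> range f"
  shows "Poly_Mapping.lookup (push f p) l = 0"
  using assms by (auto simp: push_def lookup_sum lookup_single when_def intro!: sum.neutral)

definition rename :: "('v \<Rightarrow> 'w) \<Rightarrow> ('v, 'k::comm_ring_1) mpoly \<Rightarrow> ('w, 'k) mpoly" where
  "rename f = push (push f)"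

text \<open>
  The families \<open>a\<close> and \<open>b\<close> enumerate the two sets of generators; in the big polynomial ring
  \<open>Inl i\<close> stands for \<open>X\<^sub>i\<close> and \<open>Inr j\<close> for \<open>Y\<^sub>j\<close>. Addition of sets is elementwise.
\<close>

definition is_gluing ::
    "'k::field itself \<Rightarrow> ('r::finite \<Rightarrow> 's::comm_monoid_add) \<Rightarrow> ('t::finite \<Rightarrow> 's) \<Rightarrow> bool" where
  "is_gluing _ a b \<longleftrightarrow>
     (\<exists>(\<gamma>X :: 'r \<Rightarrow>\<^sub>0 nat) (\<gamma>Y :: 't \<Rightarrow>\<^sub>0 nat) (f :: ('r + 't, 'k) mpoly).
        f = rename Inl (monomial \<gamma>X) - rename Inr (monomial \<gamma>Y) \<and>
        f \<noteq> 0 \<and>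
        f \<in> semigroup_ideal (case_sum a b) \<and>
        semigroup_ideal (case_sum a b) =
          ideal_gen (rename Inl ` semigroup_ideal a)
          + ideal_gen (rename Inr ` semigroup_ideal b)
          + ideal_gen {f})"

end

theory Submission
  imports Defs
begin

text \<open>
  A binomial lies in the ideal generated by the binomials of a congruence exactly when its two
  exponents are congruent. Two expressions \<open>a(\<alpha>) + b(\<beta>) = a(\<gamma>) + b(\<delta>)\<close> of one element give
  \<open>z = a(\<alpha>) - a(\<gamma>) = b(\<delta>) - b(\<beta>)\<close>, which ranges over \<open>G(S\<^sub>1) \<inter> G(S\<^sub>2)\<close>. If \<open>z = n d\<close>, the binomial
  reduces to the \<open>n\<close>-th power of the gluing relation. Conversely, all three generating sets of
  a gluing preserve the \<open>a\<close>-part of the weight modulo \<open>d\<close>, so \<open>z\<close> is a multiple of \<open>d\<close>.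
\<close>

section \<open>Pushing forward\<close>

text \<open>Additivity of \<open>push\<close> compares sums over different supports; this moves them
  all to one finite index set.\<close>

lemma push_eq_sum_superset:
  assumes "finite K" and "Poly_Mapping.keys p \<subseteq> K"
  shows "push f p = (\<Sum>k\<in>K. Poly_Mapping.single (f k) (Poly_Mapping.lookup p k))"
  unfolding push_def using assms by (intro sum.mono_neutral_left) (auto simp: in_keys_iff)

lemma push_add: "push f (p + q) = push f p + push f q"
proof -
  let ?K = "Poly_Mapping.keys p \<union> Poly_Mapping.keys q"
  have "push f r = (\<Sum>k\<in>?K. Poly_Mapping.single (f k) (Poly_Mapping.lookup r k))"
    if "r \<in> {p, q, p + q}" for r
    using that Poly_Mapping.keys_add[of p q] by (intro push_eq_sum_superset) auto
  then show ?thesis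
    by (simp add: lookup_add single_add sum.distrib)
qed

lemma push_zero [simp]: "push f 0 = 0"
  by (simp add: push_def)

lemma push_single [simp]: "push f (Poly_Mapping.single k v) = Poly_Mapping.single (f k) v"
  by (cases "v = 0") (simp_all add: push_def)

lemma push_diff:
  fixes p q :: "'a \<Rightarrow>\<^sub>0 'c::ab_group_add"
  shows "push f (p - q) = push f p - push f q"
  by (metis add_diff_cancel_right' diff_add_cancel push_add)

text \<open>A finitely supported function is the finite sum of its singles. For exponents the
  singles are powers of one variable, for polynomials they are terms.\<close>

lemma poly_mapping_additive_induct [case_names zero single add]:
  fixes p :: "'a \<Rightarrow>\<^sub>0 'c::comm_monoid_add"
  assumes "P 0" and "\<And>k v. P (Poly_Mapping.single k v)" and "\<And>p q. P p \<Longrightarrow> P q \<Longrightarrow> P (p + q)"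
  shows "P p"
proof -
  have "P (\<Sum>k\<in>K. Poly_Mapping.single k (Poly_Mapping.lookup p k))" if "finite K" for K
    using that by (induction K) (auto simp: assms)
  moreover have "push id p = p"
    using lookup_push[of id p] by (intro poly_mapping_eqI) auto
  ultimately show ?thesis
    by (metis (no_types, lifting) finite_keys id_apply push_def sum.cong)
qed

section \<open>Renaming variables; the X-part and the Y-part of an exponent\<close>

lemma rename_monomial: "rename f (monomial \<alpha>) = monomial (push f \<alpha>)"
  by (simp add: rename_def monomial_def)

lemma rename_diff: "rename f (p - q) = rename f p - rename f q"
  by (simp add: rename_def push_diff)

text \<open>Both sides are additive in each factor, so two nested inductions leave products of
  terms, where \<open>push_add\<close> on exponents decides.\<close>

lemma rename_mult: "rename f (p * q) = rename f p * rename f q"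
proof (induction p rule: poly_mapping_additive_induct)
  case zero
  show ?case by (simp add: rename_def)
next
  case (single k v)
  show ?case
    by (induction q rule: poly_mapping_additive_induct)
      (simp_all add: rename_def mult_single push_add distrib_left)
next
  case (add p p')
  then show ?case by (simp add: rename_def push_add distrib_right)
qed

lemma monomial_mult: "monomial \<alpha> * monomial \<beta> = monomial (\<alpha> + \<beta>)"
  by (simp add: monomial_def mult_single)

lemma monomial_eq_iff:
  "(monomial \<alpha> :: ('v, 'k::field) mpoly) = monomial \<beta> \<longleftrightarrow> \<alpha> = \<beta>"
proof
  assume "(monomial \<alpha> :: ('v, 'k) mpoly) = monomial \<beta>"
  then have "Poly_Mapping.lookup (monomial \<alpha> :: ('v, 'k) mpoly) \<alpha> = Poly_Mapping.lookup (monomial \<beta>) \<alpha>"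
    by simp
  then show "\<alpha> = \<beta>"
    by (auto simp: monomial_def lookup_single when_def split: if_splits)
qed simp

lemma exponent_decomposition:
  fixes \<xi> :: "'r + 't \<Rightarrow>\<^sub>0 nat"
  obtains \<alpha> \<beta> where "\<xi> = push Inl \<alpha> + push Inr \<beta>"
proof -
  have "\<exists>\<alpha> \<beta>. \<xi> = push Inl \<alpha> + push Inr \<beta>"
  proof (induction \<xi> rule: poly_mapping_additive_induct)
    case zero
    show ?case by (intro exI[of _ 0]) simp
  next
    case (single k v)
    show ?case
    proof (cases k)
      case (Inl i)
      then show ?thesis
        by (intro exI[of _ "Poly_Mapping.single i v"] exI[of _ 0]) simp
    next
      case (Inr j)
      then show ?thesis
        by (intro exI[of _ 0] exI[of _ "Poly_Mapping.single j v"]) simp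
    qed
  next
    case (add p q)
    then obtain \<alpha> \<beta> \<alpha>' \<beta>' where "p = push Inl \<alpha> + push Inr \<beta>" "q = push Inl \<alpha>' + push Inr \<beta>'"
      by blast
    then have "p + q = push Inl (\<alpha> + \<alpha>') + push Inr (\<beta> + \<beta>')"
      by (simp add: push_add ac_simps)
    then show ?case by blast
  qed
  with that show thesis by blast
qed


section \<open>Ideals generated by binomials\<close>

interpretation ideal: module "(*) :: 'a::comm_ring_1 \<Rightarrow> 'a \<Rightarrow> 'a"
  by standard (simp_all add: algebra_simps)

text \<open>Turns the three ideals of a gluing into one with explicit generators, so that inclusions
  are checked on generators.\<close>

lemma ideal_gen_add3:
  "ideal_gen A + ideal_gen B + ideal_gen C = ideal_gen (A \<union> B \<union> C)"
  unfolding ideal_gen_def ideal.span_Un by (auto simp: set_plus_def)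

lemma ideal_gen_subset_iff: "ideal_gen A \<subseteq> ideal_gen B \<longleftrightarrow> A \<subseteq> ideal_gen B"
  unfolding ideal_gen_def by (meson ideal.span_minimal ideal.span_superset ideal.subspace_span order_trans)

text \<open>With membership of x - y read as congruence modulo the ideal, this is transitivity;
  \<open>ideal_gen_mult\<close> is compatibility with multiplication.\<close>

lemma ideal_gen_telescope:
  assumes "x - y \<in> ideal_gen B" and "y - z \<in> ideal_gen B"
  shows "x - z \<in> ideal_gen B"
  using ideal.span_add[OF assms[unfolded ideal_gen_def]] by (simp add: ideal_gen_def)

lemma ideal_gen_mult: "x - y \<in> ideal_gen B \<Longrightarrow> c * x - c * y \<in> ideal_gen B"
  unfolding ideal_gen_def by (metis ideal.span_scale right_diff_distrib)

text \<open>Allowing any relation covers both equality of weights, which gives the semigroup ideals,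
  and the coarser equality of grades modulo a subgroup.\<close>

definition binomial_ideal :: "(('v \<Rightarrow>\<^sub>0 nat) \<Rightarrow> ('v \<Rightarrow>\<^sub>0 nat) \<Rightarrow> bool) \<Rightarrow> ('v, 'k::comm_ring_1) mpoly set"
  where "binomial_ideal R = ideal_gen {monomial \<alpha> - monomial \<beta> | \<alpha> \<beta>. R \<alpha> \<beta>}"

definition congruence :: "('e::comm_monoid_add \<Rightarrow> 'e \<Rightarrow> bool) \<Rightarrow> bool" where
  "congruence R \<longleftrightarrow> equivp R \<and> (\<forall>\<alpha> \<beta> \<gamma>. R \<alpha> \<beta> \<longrightarrow> R (\<gamma> + \<alpha>) (\<gamma> + \<beta>))"

lemma congruence_add_left: "congruence R \<Longrightarrow> R \<alpha> \<beta> \<Longrightarrow> R (\<gamma> + \<alpha>) (\<gamma> + \<beta>)"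
  by (simp add: congruence_def)

lemma congruence_classes: "congruence R \<Longrightarrow> R \<alpha> = R \<beta> \<longleftrightarrow> R \<alpha> \<beta>"
  by (simp add: congruence_def equivp_def)

lemma monomial_diff_in_binomial_ideal: "R \<alpha> \<beta> \<Longrightarrow> monomial \<alpha> - monomial \<beta> \<in> binomial_ideal R"
  unfolding binomial_ideal_def ideal_gen_def by (rule ideal.span_base) blast

text \<open>
  \<open>push R\<close> adds up the coefficients over each congruence class, since the predicate \<open>R \<alpha>\<close>
  is the class of \<open>\<alpha>\<close>.
\<close>

lemma push_binomial_ideal:
  assumes R: "congruence R" and "p \<in> binomial_ideal R"
  shows "push R p = 0"
proof -
  \<comment> \<open>The ideal consists of sums of multiples of generators. For a single term as
    multiplier, translation by \<open>k\<close> keeps both exponents in one class, and their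
    coefficients cancel.\<close>
  have gen: "push R (c * (monomial \<alpha> - monomial \<beta>)) = 0" if "R \<alpha> \<beta>"
    for c :: "('a, 'b) mpoly" and \<alpha> \<beta>
  proof (induction c rule: poly_mapping_additive_induct)
    case (single k v)
    have "R (k + \<alpha>) = R (k + \<beta>)"
      using that by (simp add: congruence_classes[OF R] congruence_add_left[OF R])
    then show ?case
      by (simp add: right_diff_distrib push_diff monomial_def mult_single)
  qed (simp_all add: distrib_right push_add)
  show ?thesis
    using assms(2) unfolding binomial_ideal_def ideal_gen_def
  proof (induction rule: ideal.span_induct_alt)
    case base
    show ?case by simp
  next
    case (step c x y)
    then show ?case using gen by (auto simp: push_add)
  qed
qed

lemma monomial_diff_in_binomial_ideal_iff:
  assumes "congruence R"
  shows "(monomial \<alpha> - monomial \<beta> :: ('v, 'k::field) mpoly) \<in> binomial_ideal R \<longleftrightarrow> R \<alpha> \<beta>"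
proof
  assume "(monomial \<alpha> - monomial \<beta> :: ('v, 'k) mpoly) \<in> binomial_ideal R"
  \<comment> \<open>At the class of \<open>\<alpha>\<close> the left coefficient is 1, and the right
    one is 0 unless the classes agree.\<close>
  from push_binomial_ideal[OF assms this]
  have "Poly_Mapping.lookup (Poly_Mapping.single (R \<alpha>) (1::'k)) (R \<alpha>)
      = Poly_Mapping.lookup (Poly_Mapping.single (R \<beta>) 1) (R \<alpha>)"
    by (simp add: push_diff monomial_def)
  then show "R \<alpha> \<beta>"
    by (simp add: lookup_single when_def congruence_classes[OF assms, symmetric] split: if_splits)
qed (rule monomial_diff_in_binomial_ideal)

text \<open>\<open>rename f\<close> is additive and multiplicative, so it carries one ideal into
  another as soon as it carries the generators there.\<close>

lemma rename_binomial_ideal: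
  assumes "\<And>\<alpha> \<beta>. R \<alpha> \<beta> \<Longrightarrow> R' (push f \<alpha>) (push f \<beta>)"
  shows "rename f ` binomial_ideal R \<subseteq> binomial_ideal R'"
proof
  fix q :: "('b, 'c) mpoly" assume "q \<in> rename f ` binomial_ideal R"
  then obtain p where q: "q = rename f p" and "p \<in> binomial_ideal R" by blast
  from this(2) have "rename f p \<in> ideal.span {monomial \<alpha> - monomial \<beta> | \<alpha> \<beta>. R' \<alpha> \<beta>}"
    unfolding binomial_ideal_def ideal_gen_def
  proof (induction rule: ideal.span_induct_alt)
    case base
    show ?case by (simp add: rename_def ideal.span_zero)
  next
    case (step c x y)
    then obtain \<alpha> \<beta> where x: "x = monomial \<alpha> - monomial \<beta>" and "R \<alpha> \<beta>" by blast
    have "rename f x = monomial (push f \<alpha>) - monomial (push f \<beta>)"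
      unfolding x by (simp add: rename_diff rename_monomial)
    with assms[OF \<open>R \<alpha> \<beta>\<close>] have "rename f x \<in> ideal.span {monomial \<alpha> - monomial \<beta> | \<alpha> \<beta>. R' \<alpha> \<beta>}"
      by (intro ideal.span_base) blast
    moreover have "rename f (c * x + y) = rename f c * rename f x + rename f y"
      by (simp add: rename_mult[symmetric]) (simp add: rename_def push_add)
    ultimately show ?case
      using step.IH by (simp add: ideal.span_add ideal.span_scale)
  qed
  then show "q \<in> binomial_ideal R'"
    by (simp add: q binomial_ideal_def ideal_gen_def)
qed


section \<open>Weights\<close>

text \<open>A constant sum over \<open>{..<n}\<close> stands for the multiple n c; this is (m + n) c
  = m c + n c.\<close>

lemma sum_const_lessThan_add:
  "(\<Sum>i<m + n. c) = (\<Sum>i<m. c) + (\<Sum>i<n::nat. c :: 's::comm_monoid_add)"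
  by (induction n) (simp_all add: ac_simps)

lemma weight_zero [simp]: "weight c 0 = 0"
  by (simp add: weight_def)

lemma weight_add: "weight c (\<alpha> + \<beta>) = weight c \<alpha> + weight c \<beta>"
  by (simp add: weight_def lookup_add sum_const_lessThan_add sum.distrib)

lemma weight_single: "weight c (Poly_Mapping.single v n) = (\<Sum>i<n. c v)"
proof -
  have "weight c (Poly_Mapping.single v n) = (\<Sum>u\<in>UNIV. if u = v then \<Sum>i<n. c v else 0)"
    unfolding weight_def by (intro sum.cong) (auto simp: lookup_single when_def)
  then show ?thesis by simp
qed

lemma weight_sum_const: "weight c (\<Sum>i<n::nat. \<alpha>) = (\<Sum>i<n. weight c \<alpha>)"
  by (induction n) (simp_all add: weight_add)

lemma weight_push: "weight c (push f \<alpha>) = weight (c \<circ> f) \<alpha>"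
  by (induction \<alpha> rule: poly_mapping_additive_induct)
    (simp_all add: push_add weight_add weight_single)

text \<open>Serves the family \<open>case_sum a (\<lambda>_. 0)\<close>, whose weight is the
  contribution of the X-variables alone.\<close>

lemma weight_const_zero: "weight (\<lambda>_. 0) \<alpha> = 0"
  by (simp add: weight_def)

lemma weight_case_sum:
  "weight (case_sum a b) (push Inl \<alpha> + push Inr \<beta>) = weight a \<alpha> + weight b \<beta>"
  by (simp add: weight_add weight_push comp_def)

text \<open>Lets elements of a generated subsemigroup be handled as exponents, the language of the
  ideals.\<close>

lemma range_weight: "range (weight c) = monoid_closure (range c)"
proof (intro equalityI subsetI)
  fix x assume "x \<in> monoid_closure (range c)"
  then show "x \<in> range (weight c)"
  proof induction
    case zero
    have "0 = weight c 0" by simp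
    then show ?case by blast
  next
    case (base x)
    then obtain v where "x = c v" by blast
    then have "x = weight c (Poly_Mapping.single v 1)" by (simp add: weight_single)
    then show ?case by blast
  next
    case (add x y)
    then obtain \<alpha> \<beta> where "x = weight c \<alpha>" "y = weight c \<beta>" by blast
    then have "x + y = weight c (\<alpha> + \<beta>)" by (simp add: weight_add)
    then show ?case by blast
  qed
next
  fix x assume "x \<in> range (weight c)"
  then obtain \<alpha> where x: "x = weight c \<alpha>" by blast
  have "(\<Sum>i<n::nat. c v) \<in> monoid_closure (range c)" for n v
    by (induction n) (auto intro: monoid_closure.intros)
  then have "weight c \<alpha> \<in> monoid_closure (range c)"
    by (induction \<alpha> rule: poly_mapping_additive_induct)
      (auto simp: weight_single weight_add intro: monoid_closure.intros)
  with x show "x \<in> monoid_closure (range c)" by simp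
qed

lemma congruence_weight: "congruence (\<lambda>\<alpha> \<beta>. weight c \<alpha> = weight c \<beta>)"
  by (auto simp: congruence_def equivp_def weight_add fun_eq_iff)

lemma semigroup_ideal_eq: "semigroup_ideal c = binomial_ideal (\<lambda>\<alpha> \<beta>. weight c \<alpha> = weight c \<beta>)"
  by (simp add: semigroup_ideal_def binomial_ideal_def)

section \<open>Reducedness, minimality and vanishing weights\<close>

lemma reduced_add_eq_zero:
  assumes "cancellative TYPE('s::comm_monoid_add)" and "reduced TYPE('s)" and "x + y = (0::'s)"
  shows "x = 0"
proof -
  have "incl x = - incl y"
    using assms(3) by (metis incl_add incl_zero add_eq_0_iff2)
  \<comment> \<open>\<open>incl x\<close> lies in S and, being \<open>- incl y\<close>, also in -S;
    injectivity of \<open>incl\<close> then brings x = 0 back to S.\<close>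
  then have "incl x \<in> range incl \<inter> uminus ` range incl"
    by blast
  then have "incl x = incl 0"
    using assms(2) unfolding reduced_def incl_zero by blast
  then show ?thesis
    using inj_incl[OF assms(1)] by (simp add: inj_eq)
qed

text \<open>Every closure contains 0, so removing 0 from a generating set generates the same
  semigroup, which minimality excludes.\<close>

lemma minimally_generates_nonzero:
  assumes "minimally_generates A"
  shows "0 \<notin> A"
proof
  assume "0 \<in> A"
  then have "A - {0} \<subset> A" by blast
  moreover have "x \<in> monoid_closure (A - {0})" if "x \<in> monoid_closure A" for x
    using that
  proof induction
    case (base x)
    then show ?case by (cases "x = 0") (auto intro: monoid_closure.intros)
  qed (auto intro: monoid_closure.intros)
  ultimately show False
    using assms unfolding minimally_generates_def by blast
qed

text \<open>Where a vanishing sum has only vanishing summands, each generator's multiple must be 0,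
  and a positive multiplicity would make the generator itself 0.\<close>

lemma weight_eq_zero:
  assumes "\<And>x y :: 's::comm_monoid_add. x + y = 0 \<Longrightarrow> x = 0"
    and "0 \<notin> range c" and "weight c \<alpha> = (0 :: 's)"
  shows "\<alpha> = 0"
proof (rule poly_mapping_eqI)
  fix v
  have "(\<Sum>i<Poly_Mapping.lookup \<alpha> v. c v) = 0"
    using assms(3) unfolding weight_def by (subst (asm) sum.remove[of _ v]) (auto dest: assms(1))
  then show "Poly_Mapping.lookup \<alpha> v = Poly_Mapping.lookup 0 v"
    using assms(1,2)
    by (cases "Poly_Mapping.lookup \<alpha> v") (auto simp: image_iff add.commute dest: assms(1))
qed


section \<open>Groups of differences\<close>

text \<open>The range of a weight is closed under addition, so differences of its elements are
  already closed under subtraction.\<close>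

lemma group_of_range_weight:
  "group_of (range (weight c)) = {incl (weight c \<alpha>) - incl (weight c \<beta>) | \<alpha> \<beta>. True}"
proof (intro equalityI subsetI)
  fix z assume "z \<in> group_of (range (weight c))"
  then show "z \<in> {incl (weight c \<alpha>) - incl (weight c \<beta>) | \<alpha> \<beta>. True}"
    unfolding group_of_def
  proof induction
    case (base z)
    \<comment> \<open>The base case of \<open>group_closure\<close> also admits 0, the weight of the
      zero exponent.\<close>
    then obtain \<alpha> where "z = incl (weight c \<alpha>)"
      by (metis imageE incl_zero insertE weight_zero)
    then have "z = incl (weight c \<alpha>) - incl (weight c 0)"
      by (simp add: incl_zero)
    then show ?case by blast
  next
    case (diff z z')
    then obtain \<alpha> \<beta> \<alpha>' \<beta>' where "z = incl (weight c \<alpha>) - incl (weight c \<beta>)"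
      "z' = incl (weight c \<alpha>') - incl (weight c \<beta>')"
      by blast
    then have "z - z' = incl (weight c (\<alpha> + \<beta>')) - incl (weight c (\<beta> + \<alpha>'))"
      by (simp add: weight_add incl_add)
    then show ?case by blast
  qed
next
  fix z assume "z \<in> {incl (weight c \<alpha>) - incl (weight c \<beta>) | \<alpha> \<beta>. True}"
  then show "z \<in> group_of (range (weight c))"
    unfolding group_of_def by (blast intro: group_closure.diff group_closure.base)
qed

lemma mem_group_closure_singleton:
  assumes "z \<in> group_closure {incl d}"
  obtains n :: nat where "z = incl (\<Sum>i<n. d)" | n :: nat where "z = - incl (\<Sum>i<n. d)"
proof -
  let ?d = "\<lambda>n::nat. incl (\<Sum>i<n. d)"
  \<comment> \<open>Differences of natural multiples are stable under the \<open>diff\<close> rule;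
    cancelling the smaller multiple settles the sign afterwards.\<close>
  have "\<exists>m n. z = ?d m - ?d n"
    using assms
  proof induction
    case (base z)
    have "z = ?d 0 - ?d 0 \<or> z = ?d 1 - ?d 0"
      using base by (auto simp: incl_zero)
    then show ?case by blast
  next
    case (diff z z')
    then obtain m n m' n' where "z = ?d m - ?d n" "z' = ?d m' - ?d n'"
      by blast
    then have "z - z' = ?d (m + n') - ?d (n + m')"
      unfolding sum_const_lessThan_add incl_add by simp
    then show ?case by blast
  qed
  then obtain m n where z: "z = ?d m - ?d n" by blast
  show thesis
  proof (cases "n \<le> m")
    case True
    then have "?d m = ?d n + ?d (m - n)"
      unfolding incl_add[symmetric] sum_const_lessThan_add[symmetric] by simp
    then show thesis using z that(1) by simp
  next
    case False
    then have "?d n = ?d m + ?d (n - m)"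
      unfolding incl_add[symmetric] sum_const_lessThan_add[symmetric] by simp
    then show thesis using z that(2) by simp
  qed
qed

text \<open>Congruence modulo a subgroup of G(S), pulled back along the additive map from exponents
  to G(S).\<close>

lemma congruence_group_closure:
  "congruence (\<lambda>\<alpha> \<beta>. incl (weight c \<alpha>) - incl (weight c \<beta>) \<in> group_closure S)"
  unfolding congruence_def
proof (intro conjI equivpI reflpI sympI transpI allI impI)
  fix \<alpha> \<beta> assume "incl (weight c \<alpha>) - incl (weight c \<beta>) \<in> group_closure S"
  then show "incl (weight c \<beta>) - incl (weight c \<alpha>) \<in> group_closure S"
    by (metis group_closure_minus_iff minus_diff_eq)
next
  fix \<alpha> \<beta> \<gamma>
  assume "incl (weight c \<alpha>) - incl (weight c \<beta>) \<in> group_closure S"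
    "incl (weight c \<beta>) - incl (weight c \<gamma>) \<in> group_closure S"
  from group_closure_add[OF this] show "incl (weight c \<alpha>) - incl (weight c \<gamma>) \<in> group_closure S"
    by simp
qed (simp_all add: weight_add incl_add)


section \<open>Gluings\<close>

text \<open>Both monomials of the gluing binomial must represent the same element, which will be the
  d of the theorem.\<close>

lemma gluing_mem_iff:
  fixes a :: "'r::finite \<Rightarrow> 's::comm_monoid_add" and b :: "'t::finite \<Rightarrow> 's"
  shows "rename Inl (monomial \<gamma>X) - rename Inr (monomial \<gamma>Y)
      \<in> (semigroup_ideal (case_sum a b) :: ('r + 't, 'k::field) mpoly set)
    \<longleftrightarrow> weight a \<gamma>X = weight b \<gamma>Y"
  unfolding rename_monomial semigroup_ideal_eq
    monomial_diff_in_binomial_ideal_iff[OF congruence_weight]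
  by (simp add: weight_push comp_def)

lemma gluing_ideal_subset:
  fixes a :: "'r::finite \<Rightarrow> 's::comm_monoid_add" and b :: "'t::finite \<Rightarrow> 's"
  assumes "cancellative TYPE('s)"
    and eq: "semigroup_ideal (case_sum a b)
      = ideal_gen (rename Inl ` semigroup_ideal a) + ideal_gen (rename Inr ` semigroup_ideal b)
        + ideal_gen {rename Inl (monomial \<gamma>X) - rename Inr (monomial \<gamma>Y) :: ('r + 't, 'k::field) mpoly}"
  shows "group_of (range (weight a)) \<inter> group_of (range (weight b))
    \<subseteq> group_closure {incl (weight a \<gamma>X)}"
proof
  txt \<open>Grade the monomials by the \<open>a\<close>-part of their weight modulo \<open>d\<close>.\<close>
  let ?w = "weight (case_sum a (\<lambda>_. 0))"
  let ?R = "\<lambda>\<xi> \<eta>. incl (?w \<xi>) - incl (?w \<eta>) \<in> group_closure {incl (weight a \<gamma>X)}"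
  let ?f = "rename Inl (monomial \<gamma>X) - rename Inr (monomial \<gamma>Y) :: ('r + 't, 'k) mpoly"
  \<comment> \<open>Binomials from \<open>a\<close> keep the grade, those from \<open>b\<close> have
    grade 0 on both sides, and the gluing binomial shifts it by exactly d, the weight of
    \<open>\<gamma>X\<close>.\<close>
  have "rename Inl ` semigroup_ideal a \<subseteq> (binomial_ideal ?R :: ('r + 't, 'k) mpoly set)"
    unfolding semigroup_ideal_eq
    by (rule rename_binomial_ideal) (simp add: weight_push comp_def)
  moreover have "rename Inr ` semigroup_ideal b \<subseteq> (binomial_ideal ?R :: ('r + 't, 'k) mpoly set)"
    unfolding semigroup_ideal_eq
    by (rule rename_binomial_ideal) (simp add: weight_push comp_def weight_const_zero)
  moreover have "?f \<in> binomial_ideal ?R"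
    unfolding rename_monomial
    by (rule monomial_diff_in_binomial_ideal)
      (auto simp: weight_push comp_def weight_const_zero incl_zero intro: group_closure.base)
  ultimately have sub: "semigroup_ideal (case_sum a b) \<subseteq> (binomial_ideal ?R :: ('r + 't, 'k) mpoly set)"
    unfolding eq ideal_gen_add3 by (simp add: binomial_ideal_def ideal_gen_subset_iff)
  fix z assume "z \<in> group_of (range (weight a)) \<inter> group_of (range (weight b))"
  then obtain \<alpha> \<gamma> \<delta> \<beta> where za: "z = incl (weight a \<alpha>) - incl (weight a \<gamma>)"
    and zb: "z = incl (weight b \<delta>) - incl (weight b \<beta>)"
    unfolding group_of_range_weight by blast
  let ?\<xi> = "push Inl \<alpha> + push Inr \<beta>" and ?\<eta> = "push Inl \<gamma> + push Inr \<delta>"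
  \<comment> \<open>Moving the negative terms across leaves an X-part and a Y-part on each side;
    cancellativity then brings the relation from G(S) back to S.\<close>
  have "incl (weight a \<alpha> + weight b \<beta>) = incl (weight a \<gamma> + weight b \<delta>)"
    using za zb by (simp add: incl_add algebra_simps)
  then have "weight (case_sum a b) ?\<xi> = weight (case_sum a b) ?\<eta>"
    unfolding weight_case_sum using inj_incl[OF assms(1)] by (simp add: inj_eq)
  then have "(monomial ?\<xi> - monomial ?\<eta> :: ('r + 't, 'k) mpoly) \<in> semigroup_ideal (case_sum a b)"
    unfolding semigroup_ideal_eq by (rule monomial_diff_in_binomial_ideal)
  with sub have "(monomial ?\<xi> - monomial ?\<eta> :: ('r + 't, 'k) mpoly) \<in> binomial_ideal ?R"
    by blast
  then have "?R ?\<xi> ?\<eta>"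
    by (simp only: monomial_diff_in_binomial_ideal_iff[OF congruence_group_closure])
  \<comment> \<open>The Y-parts have grade 0, so the difference of the two grades is z.\<close>
  then show "z \<in> group_closure {incl (weight a \<gamma>X)}"
    by (simp add: weight_case_sum weight_const_zero za)
qed

text \<open>
  Modulo the ideal, with \<open>n d\<close> moved from the \<open>a\<close>-side to the \<open>b\<close>-side,
  \<open>X^\<alpha> Y^\<beta> = X^\<gamma> X^(n \<gamma>X) Y^\<beta> = X^\<gamma> Y^(n \<gamma>Y) Y^\<beta> = X^\<gamma> Y^\<delta>\<close>.
\<close>

lemma gluing_ideal_step:
  fixes a :: "'r::finite \<Rightarrow> 's::comm_monoid_add" and b :: "'t::finite \<Rightarrow> 's"
    and \<gamma>X :: "'r \<Rightarrow>\<^sub>0 nat" and \<gamma>Y :: "'t \<Rightarrow>\<^sub>0 nat" and n :: nat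
  defines "B \<equiv> rename Inl ` semigroup_ideal a \<union> rename Inr ` semigroup_ideal b
    \<union> {rename Inl (monomial \<gamma>X) - rename Inr (monomial \<gamma>Y) :: ('r + 't, 'k::field) mpoly}"
  assumes d: "weight a \<gamma>X = d" "weight b \<gamma>Y = d"
    and \<alpha>: "weight a \<alpha> = weight a \<gamma> + (\<Sum>i<n. d)"
    and \<delta>: "weight b \<delta> = weight b \<beta> + (\<Sum>i<n. d)"
  shows "monomial (push Inl \<alpha> + push Inr \<beta>) - monomial (push Inl \<gamma> + push Inr \<delta>) \<in> ideal_gen B"
proof -
  let ?X = "\<lambda>\<xi>. rename Inl (monomial \<xi>) :: ('r + 't, 'k) mpoly"
  let ?Y = "\<lambda>\<xi>. rename Inr (monomial \<xi>) :: ('r + 't, 'k) mpoly"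
  have base: "x \<in> B \<Longrightarrow> x \<in> ideal_gen B" for x
    unfolding ideal_gen_def by (rule ideal.span_base)
  have X: "?X \<xi> - ?X \<eta> \<in> ideal_gen B" if "weight a \<xi> = weight a \<eta>" for \<xi> \<eta>
  proof (rule base)
    have "(monomial \<xi> - monomial \<eta> :: ('r, 'k) mpoly) \<in> semigroup_ideal a"
      unfolding semigroup_ideal_eq using that by (rule monomial_diff_in_binomial_ideal)
    then show "?X \<xi> - ?X \<eta> \<in> B"
      unfolding B_def rename_diff[symmetric] by blast
  qed
  have Y: "?Y \<xi> - ?Y \<eta> \<in> ideal_gen B" if "weight b \<xi> = weight b \<eta>" for \<xi> \<eta>
  proof (rule base)
    have "(monomial \<xi> - monomial \<eta> :: ('t, 'k) mpoly) \<in> semigroup_ideal b"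
      unfolding semigroup_ideal_eq using that by (rule monomial_diff_in_binomial_ideal)
    then show "?Y \<xi> - ?Y \<eta> \<in> B"
      unfolding B_def rename_diff[symmetric] by blast
  qed
  have f: "?X \<gamma>X - ?Y \<gamma>Y \<in> ideal_gen B"
    by (rule base) (simp add: B_def)
  have power: "?X (\<Sum>i<m. \<gamma>X) - ?Y (\<Sum>i<m. \<gamma>Y) \<in> ideal_gen B" for m :: nat
  proof (induction m)
    case 0
    show ?case by (simp add: rename_monomial ideal_gen_def ideal.span_zero)
  next
    case (Suc m)
    \<comment> \<open>The mixed product links the two sides: first one factor is exchanged, then the
      remaining m by induction.\<close>
    have "?X (\<Sum>i<m. \<gamma>X) * ?X \<gamma>X - ?X (\<Sum>i<m. \<gamma>X) * ?Y \<gamma>Y \<in> ideal_gen B"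
      using f by (rule ideal_gen_mult)
    moreover
    have "?Y \<gamma>Y * ?X (\<Sum>i<m. \<gamma>X) - ?Y \<gamma>Y * ?Y (\<Sum>i<m. \<gamma>Y) \<in> ideal_gen B"
      using Suc by (rule ideal_gen_mult)
    then have "?X (\<Sum>i<m. \<gamma>X) * ?Y \<gamma>Y - ?Y (\<Sum>i<m. \<gamma>Y) * ?Y \<gamma>Y \<in> ideal_gen B"
      by (simp only: mult.commute)
    ultimately have "?X (\<Sum>i<m. \<gamma>X) * ?X \<gamma>X - ?Y (\<Sum>i<m. \<gamma>Y) * ?Y \<gamma>Y \<in> ideal_gen B"
      by (rule ideal_gen_telescope)
    then show ?case
      by (simp add: rename_mult[symmetric] monomial_mult)
  qed
  let ?P = "\<Sum>i<n. \<gamma>X" and ?Q = "\<Sum>i<n. \<gamma>Y"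
  \<comment> \<open>\<open>?u\<close> and \<open>?v\<close> are the two middle monomials of the
    chain, with the factors untouched by the n-fold exchange in front.\<close>
  let ?u = "?Y \<beta> * ?X \<gamma> * ?X ?P" and ?v = "?Y \<beta> * ?X \<gamma> * ?Y ?Q"
  have "?Y \<beta> * ?X (\<gamma> + ?P) = ?u"
    by (simp only: monomial_mult[symmetric] rename_mult mult.assoc)
  moreover have "?Y \<beta> * ?X \<alpha> - ?Y \<beta> * ?X (\<gamma> + ?P) \<in> ideal_gen B"
    by (intro ideal_gen_mult X) (simp add: \<alpha> weight_add weight_sum_const d)
  ultimately have "?Y \<beta> * ?X \<alpha> - ?u \<in> ideal_gen B"
    by (simp only:)
  moreover have "?u - ?v \<in> ideal_gen B"
    by (intro ideal_gen_mult power)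
  ultimately have uv: "?Y \<beta> * ?X \<alpha> - ?v \<in> ideal_gen B"
    by (rule ideal_gen_telescope)
  have "?X \<gamma> * ?Y (\<beta> + ?Q) = ?v"
    by (simp only: monomial_mult[symmetric] rename_mult mult_ac)
  moreover have "?X \<gamma> * ?Y (\<beta> + ?Q) - ?X \<gamma> * ?Y \<delta> \<in> ideal_gen B"
    by (intro ideal_gen_mult Y) (simp add: \<delta> weight_add weight_sum_const d)
  ultimately have "?v - ?X \<gamma> * ?Y \<delta> \<in> ideal_gen B"
    by (simp only:)
  with uv have "?Y \<beta> * ?X \<alpha> - ?X \<gamma> * ?Y \<delta> \<in> ideal_gen B"
    by (rule ideal_gen_telescope)
  then show ?thesis
    by (simp add: rename_monomial monomial_mult add.commute)
qed

lemma gluing_ideal_eq: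
  fixes a :: "'r::finite \<Rightarrow> 's::comm_monoid_add" and b :: "'t::finite \<Rightarrow> 's"
  assumes d: "weight a \<gamma>X = d" "weight b \<gamma>Y = d"
    and G: "group_of (range (weight a)) \<inter> group_of (range (weight b)) \<subseteq> group_closure {incl d}"
    and "cancellative TYPE('s)"
  shows "(semigroup_ideal (case_sum a b) :: ('r + 't, 'k::field) mpoly set)
      = ideal_gen (rename Inl ` semigroup_ideal a) + ideal_gen (rename Inr ` semigroup_ideal b)
        + ideal_gen {rename Inl (monomial \<gamma>X) - rename Inr (monomial \<gamma>Y)}"
    (is "?I = ideal_gen ?A + ideal_gen ?B + ideal_gen {?f}")
  unfolding ideal_gen_add3
proof
  \<comment> \<open>Relations among the \<open>a\<close> alone, or the \<open>b\<close> alone, are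
    relations of the whole family.\<close>
  have "?A \<subseteq> ?I"
    unfolding semigroup_ideal_eq by (rule rename_binomial_ideal) (simp add: weight_push comp_def)
  moreover have "?B \<subseteq> ?I"
    unfolding semigroup_ideal_eq by (rule rename_binomial_ideal) (simp add: weight_push comp_def)
  moreover have "?f \<in> ?I"
    using d by (simp add: gluing_mem_iff)
  ultimately show "ideal_gen (?A \<union> ?B \<union> {?f}) \<subseteq> ?I"
    by (simp add: semigroup_ideal_def ideal_gen_subset_iff)
next
  note inj = injD[OF inj_incl[OF assms(4)]]
  show "?I \<subseteq> ideal_gen (?A \<union> ?B \<union> {?f})"
    unfolding semigroup_ideal_def[of "case_sum a b"] ideal_gen_subset_iff
  proof clarify
    fix \<xi> \<eta> :: "'r + 't \<Rightarrow>\<^sub>0 nat"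
    assume eq: "weight (case_sum a b) \<xi> = weight (case_sum a b) \<eta>"
    obtain \<alpha> \<beta> where \<xi>: "\<xi> = push Inl \<alpha> + push Inr \<beta>"
      by (rule exponent_decomposition)
    obtain \<gamma> \<delta> where \<eta>: "\<eta> = push Inl \<gamma> + push Inr \<delta>"
      by (rule exponent_decomposition)
    let ?z = "incl (weight a \<alpha>) - incl (weight a \<gamma>)"
    have "incl (weight a \<alpha> + weight b \<beta>) = incl (weight a \<gamma> + weight b \<delta>)"
      using eq by (simp add: \<xi> \<eta> weight_case_sum)
    \<comment> \<open>The equation of total weights expresses \<open>?z\<close> on the
      \<open>b\<close>-side as well, so it lies in both groups.\<close>
    then have z: "?z = incl (weight b \<delta>) - incl (weight b \<beta>)"
      by (simp add: incl_add algebra_simps)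
    then have "?z \<in> group_closure {incl d}"
      using G unfolding group_of_range_weight by blast
    then show "monomial \<xi> - monomial \<eta> \<in> ideal_gen (?A \<union> ?B \<union> {?f})"
    proof (cases rule: mem_group_closure_singleton)
      case (1 n)
      have "weight a \<alpha> = weight a \<gamma> + (\<Sum>i<n. d)"
        by (rule inj) (use 1 in \<open>simp add: incl_add algebra_simps\<close>)
      moreover have "weight b \<delta> = weight b \<beta> + (\<Sum>i<n. d)"
        by (rule inj) (use 1 z in \<open>simp add: incl_add algebra_simps\<close>)
      ultimately show ?thesis
        unfolding \<xi> \<eta> by (rule gluing_ideal_step[OF d])
    next
      case (2 n)
      \<comment> \<open>With the negative sign d moves the other way:
        \<open>gluing_ideal_step\<close> applies with \<open>\<xi>\<close> and \<open>\<eta>\<close>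
        exchanged, and the result is negated.\<close>
      have "weight a \<gamma> = weight a \<alpha> + (\<Sum>i<n. d)"
        by (rule inj) (use 2 in \<open>simp add: incl_add algebra_simps\<close>)
      moreover have "weight b \<beta> = weight b \<delta> + (\<Sum>i<n. d)"
        by (rule inj) (use 2 z in \<open>simp add: incl_add algebra_simps\<close>)
      ultimately have "monomial \<eta> - monomial \<xi> \<in> ideal_gen (?A \<union> ?B \<union> {?f})"
        unfolding \<xi> \<eta> by (rule gluing_ideal_step[OF d])
      then show ?thesis
        unfolding ideal_gen_def by (metis ideal.span_neg minus_diff_eq)
    qed
  qed
qed

theorem proposition2:
  fixes a :: "'r::finite \<Rightarrow> 's::comm_monoid_add"
    and b :: "'t::finite \<Rightarrow> 's"
    and A\<^sub>1 A\<^sub>2 S\<^sub>1 S\<^sub>2 :: "'s set"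
  assumes "cancellative TYPE('s)"
    and "reduced TYPE('s)"
    and "inj a" and "inj b"
    and "A\<^sub>1 = range a" and "A\<^sub>2 = range b"
    and "A\<^sub>1 \<inter> A\<^sub>2 = {}"
    and "minimally_generates (A\<^sub>1 \<union> A\<^sub>2)"
    and "S\<^sub>1 = monoid_closure A\<^sub>1" and "S\<^sub>2 = monoid_closure A\<^sub>2"
  shows "is_gluing TYPE('k::field) a b \<longleftrightarrow>
    (\<exists>d \<in> (S\<^sub>1 \<inter> S\<^sub>2) - {0}. group_of S\<^sub>1 \<inter> group_of S\<^sub>2 = group_closure {incl d})"
proof -
  have S: "S\<^sub>1 = range (weight a)" "S\<^sub>2 = range (weight b)"
    using assms(5,6,9,10) by (simp_all add: range_weight)
  have nonzero: "0 \<notin> range a" "0 \<notin> range b"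
    using minimally_generates_nonzero[OF assms(8)] assms(5,6) by auto
  note reduced = reduced_add_eq_zero[OF assms(1,2)]
  \<comment> \<open>Since the generators are nonzero, reducedness makes 0 the weight of the zero
    exponent only.\<close>
  note zero = weight_eq_zero[OF reduced nonzero(1)] weight_eq_zero[OF reduced nonzero(2)]
  \<comment> \<open>This inclusion holds for every common element d, so both directions of the
    theorem turn on the opposite one.\<close>
  have dZ: "group_closure {incl d} \<subseteq> group_of S\<^sub>1 \<inter> group_of S\<^sub>2" if "d \<in> S\<^sub>1 \<inter> S\<^sub>2" for d
  proof
    fix z assume "z \<in> group_closure {incl d}"
    then show "z \<in> group_of S\<^sub>1 \<inter> group_of S\<^sub>2"
      unfolding group_of_def
      by induction (use that in \<open>auto intro: group_closure.intros\<close>)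
  qed
  show ?thesis
  proof
    assume "is_gluing TYPE('k) a b"
    then obtain \<gamma>X \<gamma>Y where
      ne: "(rename Inl (monomial \<gamma>X) - rename Inr (monomial \<gamma>Y) :: ('r + 't, 'k) mpoly) \<noteq> 0"
      and mem: "(rename Inl (monomial \<gamma>X) - rename Inr (monomial \<gamma>Y) :: ('r + 't, 'k) mpoly)
        \<in> semigroup_ideal (case_sum a b)"
      and eq: "(semigroup_ideal (case_sum a b) :: ('r + 't, 'k) mpoly set)
        = ideal_gen (rename Inl ` semigroup_ideal a) + ideal_gen (rename Inr ` semigroup_ideal b)
          + ideal_gen {rename Inl (monomial \<gamma>X) - rename Inr (monomial \<gamma>Y)}"
      unfolding is_gluing_def by blast
    let ?d = "weight a \<gamma>X"
    have d: "?d = weight b \<gamma>Y"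
      using mem by (simp only: gluing_mem_iff)
    \<comment> \<open>If d were 0, both exponents would vanish and the binomial would be 1 -
      1.\<close>
    have "?d \<noteq> 0"
    proof
      assume "?d = 0"
      with d have "\<gamma>X = 0" "\<gamma>Y = 0"
        using zero by simp_all
      with ne show False by (simp add: rename_monomial)
    qed
    moreover have dS: "?d \<in> S\<^sub>1 \<inter> S\<^sub>2"
      unfolding S using d by blast
    moreover have "group_of S\<^sub>1 \<inter> group_of S\<^sub>2 = group_closure {incl ?d}"
      using gluing_ideal_subset[OF assms(1) eq] dZ[OF dS] by (simp add: S subset_antisym)
    ultimately show "\<exists>d \<in> (S\<^sub>1 \<inter> S\<^sub>2) - {0}. group_of S\<^sub>1 \<inter> group_of S\<^sub>2 = group_closure {incl d}"
      by blast
  next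
    assume "\<exists>d \<in> (S\<^sub>1 \<inter> S\<^sub>2) - {0}. group_of S\<^sub>1 \<inter> group_of S\<^sub>2 = group_closure {incl d}"
    then obtain d where "d \<noteq> 0" and "d \<in> range (weight a)" and "d \<in> range (weight b)"
      and G: "group_of (range (weight a)) \<inter> group_of (range (weight b)) = group_closure {incl d}"
      unfolding S by blast
    then obtain \<gamma>X \<gamma>Y where d: "weight a \<gamma>X = d" "weight b \<gamma>Y = d"
      by (metis imageE)
    let ?f = "rename Inl (monomial \<gamma>X) - rename Inr (monomial \<gamma>Y) :: ('r + 't, 'k) mpoly"
    have "?f \<noteq> 0"
    proof
      assume "?f = 0"
      then have "push Inl \<gamma>X = (push Inr \<gamma>Y :: 'r + 't \<Rightarrow>\<^sub>0 nat)"
        by (simp add: rename_monomial monomial_eq_iff)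
      \<comment> \<open>Weighing only the X-variables gives d on the left and 0 on the
        right.\<close>
      then have "weight (case_sum a (\<lambda>_. 0)) (push Inl \<gamma>X :: 'r + 't \<Rightarrow>\<^sub>0 nat)
          = weight (case_sum a (\<lambda>_. 0)) (push Inr \<gamma>Y)"
        by simp
      with \<open>d \<noteq> 0\<close> d show False
        by (simp add: weight_push comp_def weight_const_zero)
    qed
    moreover have "?f \<in> semigroup_ideal (case_sum a b)"
      unfolding gluing_mem_iff using d by simp
    moreover note gluing_ideal_eq[OF d equalityD1[OF G] assms(1), where 'k = 'k]
    ultimately show "is_gluing TYPE('k) a b"
      unfolding is_gluing_def by blast
  qed
qed

end
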